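(* Let $\mathcal{H}$ be a separable Hilbert space, let $\mathcal{F}=\{f_n\}_{n\in\mathbb{N}}$ be a frame for $\mathcal{H}$, and let $\mathcal{N}\subseteq\ell^2$ be the nullspace of its synthesis operator. Then $\mathcal{F}$ is a conditional Riesz frame if and only if there exists a sequence $\{I_n\}_{n\in\mathbb{N}}$ of finite subsets of $\mathbb{N}$ such that $I_n\subseteq I_{n+1}$ for every $n$, $\bigcup_{n\in\mathbb{N}}I_n=\mathbb{N}$, and $$\sup_{n\in\mathbb{N}}c[\mathcal{N},\mathcal{M}_{I_n}]<1.$$
   Context: A sequence (finite or countable) $\{f_n\}$ in a Hilbert space $\mathcal{K}$ is a frame for $\mathcal{K}$ if there are $A,B>0$ (bounds) with $A\|f\|^2\le\sum_n|\langle f,f_n\rangle|^2\le B\|f\|^2$ for all $f\in\mathcal{K}$. The synthesis operator of a frame $\mathcal{F}=\{f_n\}_{n\in\mathbb{N}}$ is the bounded operator $T:\ell^2\to\mathcal{H}$ with $T(e_n)=f_n$, where $\{e_n\}_{n\in\mathbb{N}}$ is the canonical orthonormal basis of $\ell^2$. For $I\subseteq\mathbb{N}$: $\mathcal{F}_I=\{f_n\}_{n\in I}$ and $\mathcal{M}_I=\overline{\mathrm{span}}\{e_n:n\in I\}\subseteq\ell^2$. $\mathcal{F}_I$ is a frame sequence if it is a frame for $\overline{\mathrm{span}}\,\mathcal{F}_I$. The frame $\mathcal{F}$ is a conditional Riesz frame if there is a sequence $\{I_n\}_{n=1}^\infty$ of finite subsets of $\mathbb{N}$ with $I_n\subseteq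 I_{n+1}$ for every $n$ and $\bigcup_n I_n=\mathbb{N}$ such that there are common bounds $A,B>0$ for all the frame sequences $\mathcal{F}_{I_n}$. For closed subspaces $\mathcal{M},\mathcal{N}$ of a Hilbert space put $\tilde{\mathcal{M}}=\mathcal{M}\cap(\mathcal{M}\cap\mathcal{N})^\perp$, $\tilde{\mathcal{N}}=\mathcal{N}\cap(\mathcal{M}\cap\mathcal{N})^\perp$, and $c[\mathcal{M},\mathcal{N}]=\sup\{|\langle x,y\rangle|: x\in\tilde{\mathcal{M}},\,y\in\tilde{\mathcal{N}},\,\|x\|=\|y\|=1\}$ (with $\sup\emptyset=0$). *)

theory Defs
  imports "HOL-Analysis.Analysis"
begin

section \<open>Scalars and Hilbert spaces\<close>

text \<open>
  The scalar fields of Hilbert space theory. The first axiom for the conjugation \<open>kcnj\<close> makes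
  \<open>x + kcnj x\<close> real, the second makes \<open>x * kcnj x\<close> equal to the square of the norm; hence every scalar
  satisfies a quadratic equation over the reals, and the only instances up to isomorphism are
  the real numbers (with trivial conjugation) and the complex numbers.
\<close>

class rc_field = real_normed_field + banach +
  fixes kcnj :: "'a \<Rightarrow> 'a"
  assumes add_kcnj_real: "\<exists>r. x + kcnj x = r *\<^sub>R 1"
    and mult_kcnj_scaleR: "x * kcnj x = (norm x)\<^sup>2 *\<^sub>R 1"
    and kcnj_add: "kcnj (x + y) = kcnj x + kcnj y"
    and kcnj_mult: "kcnj (x * y) = kcnj x * kcnj y"

instantiation real :: rc_field
begin
definition kcnj_real :: "real \<Rightarrow> real" where "kcnj_real x = x"
instance by standard (auto simp: kcnj_real_def power2_eq_square)
end

instantiation complex :: rc_field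
begin
definition kcnj_complex :: "complex \<Rightarrow> complex" where "kcnj_complex x = cnj x"
instance
proof
  fix x :: complex
  show "\<exists>r. x + kcnj x = r *\<^sub>R 1"
    by (rule exI[of _ "2 * Re x"]) (simp add: kcnj_complex_def complex_add_cnj scaleR_conv_of_real)
  show "x * kcnj x = (norm x)\<^sup>2 *\<^sub>R 1"
    by (simp add: kcnj_complex_def scaleR_conv_of_real complex_norm_square[symmetric] del: of_real_power)
qed (auto simp: kcnj_complex_def)
end

lemma mult_kcnj: "x * kcnj x = of_real ((norm (x::'k::rc_field))\<^sup>2)"
  by (simp only: mult_kcnj_scaleR of_real_def)

text \<open>
  A Hilbert space over \<open>'k\<close>: a Banach space whose norm is induced by the \<open>'k\<close>-valued inner
  product \<open>ip\<close>, linear in its first argument. The topology is that of the type class.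
\<close>

locale hilbert_space = vector_space scl
  for scl :: "'k::rc_field \<Rightarrow> 'a::banach \<Rightarrow> 'a" +
  fixes ip :: "'a \<Rightarrow> 'a \<Rightarrow> 'k"
  assumes scale_of_real: "scl (of_real r) x = r *\<^sub>R x"
    and ip_add_left: "ip (x + y) z = ip x z + ip y z"
    and ip_scale_left: "ip (scl c x) z = c * ip x z"
    and ip_commute: "ip y x = kcnj (ip x y)"
    and ip_self: "ip x x = of_real ((norm x)\<^sup>2)"

definition closed_span :: "('k::rc_field \<Rightarrow> 'a::banach \<Rightarrow> 'a) \<Rightarrow> 'a set \<Rightarrow> 'a set" where
  "closed_span scl S = closure (module.span scl S)"

definition orth_complement :: "('a \<Rightarrow> 'a \<Rightarrow> 'k::rc_field) \<Rightarrow> 'a set \<Rightarrow> 'a set" where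
  "orth_complement ip S = {x. \<forall>y\<in>S. ip x y = 0}"

text \<open>
  The cosine \<open>c[M, N]\<close> of the (Friedrichs) angle between closed subspaces. Adjoining \<open>0\<close> only
  implements the convention that the supremum of the empty set is \<open>0\<close>, as all other elements
  are nonnegative.
\<close>

definition angle_cos :: "('a::banach \<Rightarrow> 'a \<Rightarrow> 'k::rc_field) \<Rightarrow> 'a set \<Rightarrow> 'a set \<Rightarrow> real" where
  "angle_cos ip M N =
     Sup (insert 0 {norm (ip x y) | x y.
       x \<in> M \<inter> orth_complement ip (M \<inter> N) \<and> y \<in> N \<inter> orth_complement ip (M \<inter> N) \<and>
       norm x = 1 \<and> norm y = 1})"


section \<open>Frames\<close>

text \<open>
  \<open>frame_with_bounds ip J f K A B\<close>: the family of all \<open>f n\<close> with \<open>n \<in> J\<close> (\<open>J\<close> finite or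
  infinite) is a frame for the subspace \<open>K\<close> with bounds \<open>A\<close> and \<open>B\<close>. Summability is required
  because \<open>infsum\<close> of a divergent family is \<open>0\<close>; it is part of the upper frame inequality.
\<close>

definition frame_with_bounds ::
    "('a::banach \<Rightarrow> 'a \<Rightarrow> 'k::rc_field) \<Rightarrow> nat set \<Rightarrow> (nat \<Rightarrow> 'a) \<Rightarrow> 'a set \<Rightarrow> real \<Rightarrow> real \<Rightarrow> bool" where
  "frame_with_bounds ip J f K A B \<longleftrightarrow>
     0 < A \<and> 0 < B \<and> f ` J \<subseteq> K \<and>
     (\<forall>x\<in>K. (\<lambda>n. (norm (ip x (f n)))\<^sup>2) summable_on J \<and>
        A * (norm x)\<^sup>2 \<le> (\<Sum>\<^sub>\<infinity>n\<in>J. (norm (ip x (f n)))\<^sup>2) \<and>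
        (\<Sum>\<^sub>\<infinity>n\<in>J. (norm (ip x (f n)))\<^sup>2) \<le> B * (norm x)\<^sup>2)"

definition is_frame :: "('a::banach \<Rightarrow> 'a \<Rightarrow> 'k::rc_field) \<Rightarrow> (nat \<Rightarrow> 'a) \<Rightarrow> bool" where
  "is_frame ip f \<longleftrightarrow> (\<exists>A B. frame_with_bounds ip UNIV f UNIV A B)"

definition frame_sequence_with_bounds ::
    "('k::rc_field \<Rightarrow> 'a::banach \<Rightarrow> 'a) \<Rightarrow> ('a \<Rightarrow> 'a \<Rightarrow> 'k) \<Rightarrow> nat set \<Rightarrow> (nat \<Rightarrow> 'a) \<Rightarrow> real \<Rightarrow> real \<Rightarrow> bool" where
  "frame_sequence_with_bounds scl ip J f A B \<longleftrightarrow>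
     frame_with_bounds ip J f (closed_span scl (f ` J)) A B"

definition finite_exhaustion :: "(nat \<Rightarrow> nat set) \<Rightarrow> bool" where
  "finite_exhaustion I \<longleftrightarrow>
     (\<forall>n. finite (I n)) \<and> (\<forall>n. I n \<subseteq> I (Suc n)) \<and> (\<Union>n. I n) = UNIV"

definition conditional_riesz_frame ::
    "('k::rc_field \<Rightarrow> 'a::banach \<Rightarrow> 'a) \<Rightarrow> ('a \<Rightarrow> 'a \<Rightarrow> 'k) \<Rightarrow> (nat \<Rightarrow> 'a) \<Rightarrow> bool" where
  "conditional_riesz_frame scl ip f \<longleftrightarrow>
     is_frame ip f \<and>
     (\<exists>I. finite_exhaustion I \<and>
        (\<exists>A B. \<forall>n. frame_sequence_with_bounds scl ip (I n) f A B))"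


section \<open>The space of square-summable sequences\<close>

lemma L2_set_le_sqrt_suminf:
  assumes "summable (\<lambda>n. (norm (x n))\<^sup>2)"
  shows "L2_set (\<lambda>n. norm (x n)) {..<k::nat} \<le> sqrt (\<Sum>n. (norm (x n))\<^sup>2)"
  unfolding L2_set_def using assms by (intro real_sqrt_le_mono sum_le_suminf) auto

lemma square_summable_bounded:
  assumes "\<And>k::nat. L2_set (\<lambda>n. norm (x n)) {..<k} \<le> c"
  shows "summable (\<lambda>n. (norm (x n))\<^sup>2)" and "sqrt (\<Sum>n. (norm (x n))\<^sup>2) \<le> c"
proof -
  have c: "0 \<le> c" using assms[of 0] by simp
  have b: "(\<Sum>n<k. (norm (x n))\<^sup>2) \<le> c\<^sup>2" for k
    using assms[of k] c unfolding L2_set_def by (simp add: real_sqrt_le_iff' sqrt_le_D)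
  show s: "summable (\<lambda>n. (norm (x n))\<^sup>2)"
    by (rule summableI_nonneg_bounded[OF _ b]) auto
  have "(\<Sum>n. (norm (x n))\<^sup>2) \<le> c\<^sup>2"
    using suminf_le_const[OF s b] .
  then show "sqrt (\<Sum>n. (norm (x n))\<^sup>2) \<le> c"
    using c real_le_lsqrt suminf_nonneg[OF s] by auto
qed

lemma square_summable_add:
  fixes x y :: "nat \<Rightarrow> 'k::real_normed_vector"
  assumes "summable (\<lambda>n. (norm (x n))\<^sup>2)" "summable (\<lambda>n. (norm (y n))\<^sup>2)"
  shows "summable (\<lambda>n. (norm (x n + y n))\<^sup>2)"
    and "sqrt (\<Sum>n. (norm (x n + y n))\<^sup>2) \<le> sqrt (\<Sum>n. (norm (x n))\<^sup>2) + sqrt (\<Sum>n. (norm (y n))\<^sup>2)"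
proof -
  have "L2_set (\<lambda>n. norm (x n + y n)) {..<k}
      \<le> sqrt (\<Sum>n. (norm (x n))\<^sup>2) + sqrt (\<Sum>n. (norm (y n))\<^sup>2)" for k
  proof -
    have "L2_set (\<lambda>n. norm (x n + y n)) {..<k} \<le> L2_set (\<lambda>n. norm (x n) + norm (y n)) {..<k}"
      by (intro L2_set_mono) (auto intro: norm_triangle_ineq)
    also have "\<dots> \<le> L2_set (\<lambda>n. norm (x n)) {..<k} + L2_set (\<lambda>n. norm (y n)) {..<k}"
      by (rule L2_set_triangle_ineq)
    also have "\<dots> \<le> sqrt (\<Sum>n. (norm (x n))\<^sup>2) + sqrt (\<Sum>n. (norm (y n))\<^sup>2)"
      using assms by (intro add_mono L2_set_le_sqrt_suminf)
    finally show ?thesis .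
  qed
  from square_summable_bounded[OF this]
  show "summable (\<lambda>n. (norm (x n + y n))\<^sup>2)"
    and "sqrt (\<Sum>n. (norm (x n + y n))\<^sup>2) \<le> sqrt (\<Sum>n. (norm (x n))\<^sup>2) + sqrt (\<Sum>n. (norm (y n))\<^sup>2)"
    by auto
qed

typedef (overloaded) 'k ell2 = "{x :: nat \<Rightarrow> 'k::rc_field. summable (\<lambda>n. (norm (x n))\<^sup>2)}"
  morphisms ell2_nth Abs_ell2
  by (rule exI[of _ "\<lambda>_. 0"]) simp

setup_lifting type_definition_ell2

lemma summable_ell2: "summable (\<lambda>n. (norm (ell2_nth x n))\<^sup>2)"
  using ell2_nth by auto

lemma ell2_eqI: "(\<And>n. ell2_nth x n = ell2_nth y n) \<Longrightarrow> x = y"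
  by (simp add: ell2_nth_inject[symmetric] fun_eq_iff)

lift_definition ell2_scale :: "'k::rc_field \<Rightarrow> 'k ell2 \<Rightarrow> 'k ell2" is "\<lambda>c x n. c * x n"
  by (simp add: norm_mult power_mult_distrib summable_mult)

instantiation ell2 :: (rc_field) real_vector
begin

lift_definition zero_ell2 :: "'a ell2" is "\<lambda>_. 0" by simp

lift_definition plus_ell2 :: "'a ell2 \<Rightarrow> 'a ell2 \<Rightarrow> 'a ell2" is "\<lambda>x y n. x n + y n"
  by (rule square_summable_add)

lift_definition uminus_ell2 :: "'a ell2 \<Rightarrow> 'a ell2" is "\<lambda>x n. - x n" by simp

lift_definition minus_ell2 :: "'a ell2 \<Rightarrow> 'a ell2 \<Rightarrow> 'a ell2" is "\<lambda>x y n. x n - y n"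
  subgoal for x y using square_summable_add(1)[of x "\<lambda>n. - y n"] by simp
  done

lift_definition scaleR_ell2 :: "real \<Rightarrow> 'a ell2 \<Rightarrow> 'a ell2" is "\<lambda>r x n. r *\<^sub>R x n"
  by (simp add: power_mult_distrib summable_mult)

instance
proof
  fix x y z :: "'a ell2" and a b :: real
  show "x + y + z = x + (y + z)" "x + y = y + x" "0 + x = x" "- x + x = 0" "x - y = x + - y"
    "a *\<^sub>R (x + y) = a *\<^sub>R x + a *\<^sub>R y" "(a + b) *\<^sub>R x = a *\<^sub>R x + b *\<^sub>R x"
    "a *\<^sub>R b *\<^sub>R x = (a * b) *\<^sub>R x" "1 *\<^sub>R x = x"
    by (transfer; simp add: algebra_simps)+
qed

end

instantiation ell2 :: (rc_field) real_normed_vector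
begin

lift_definition norm_ell2 :: "'a ell2 \<Rightarrow> real" is "\<lambda>x. sqrt (\<Sum>n. (norm (x n))\<^sup>2)" .

definition sgn_ell2 :: "'a ell2 \<Rightarrow> 'a ell2" where "sgn_ell2 x = x /\<^sub>R norm x"

definition dist_ell2 :: "'a ell2 \<Rightarrow> 'a ell2 \<Rightarrow> real" where "dist_ell2 x y = norm (x - y)"

definition uniformity_ell2 :: "('a ell2 \<times> 'a ell2) filter" where
  "uniformity_ell2 = (INF e\<in>{0<..}. principal {(x, y). dist x y < e})"

definition open_ell2 :: "'a ell2 set \<Rightarrow> bool" where
  "open_ell2 U \<longleftrightarrow> (\<forall>x\<in>U. eventually (\<lambda>(x', y). x' = x \<longrightarrow> y \<in> U) uniformity)"

instance
proof
  fix x y :: "'a ell2" and a :: real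
  show "(norm x = 0) = (x = 0)"
    by transfer (auto simp: suminf_eq_zero_iff)
  show "norm (x + y) \<le> norm x + norm y"
    by transfer (auto intro: square_summable_add(2))
  show "norm (a *\<^sub>R x) = \<bar>a\<bar> * norm x"
    by transfer (simp add: power_mult_distrib suminf_mult real_sqrt_mult)
qed (simp_all add: sgn_ell2_def dist_ell2_def uniformity_ell2_def open_ell2_def)

end

lemma ell2_nth_minus: "ell2_nth (x - y) n = ell2_nth x n - ell2_nth y n"
  by transfer simp

lemma norm_ell2_nth_le: "norm (ell2_nth x n) \<le> norm x"
proof -
  have "norm (ell2_nth x n) \<le> L2_set (\<lambda>n. norm (ell2_nth x n)) {..<Suc n}"
    by (intro member_le_L2_set) auto
  also have "\<dots> \<le> norm x"
    unfolding norm_ell2.rep_eq by (rule L2_set_le_sqrt_suminf[OF summable_ell2])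
  finally show ?thesis .
qed

instance ell2 :: (rc_field) banach
proof
  fix X :: "nat \<Rightarrow> 'a ell2"
  assume X: "Cauchy X"
  have "Cauchy (\<lambda>m. ell2_nth (X m) i)" for i
    using X unfolding Cauchy_def dist_norm
    by (metis ell2_nth_minus norm_ell2_nth_le le_less_trans)
  then have "\<forall>i. \<exists>l. (\<lambda>m. ell2_nth (X m) i) \<longlonglongrightarrow> l"
    by (simp add: Cauchy_convergent_iff convergent_def)
  then obtain y where y: "\<And>i. (\<lambda>m. ell2_nth (X m) i) \<longlonglongrightarrow> y i" by metis
  have tail: "\<exists>M. \<forall>m\<ge>M. \<forall>k. L2_set (\<lambda>i. norm (ell2_nth (X m) i - y i)) {..<k} \<le> e" if "e > 0" for e
  proof -
    from X that obtain M where M: "\<And>m n. m \<ge> M \<Longrightarrow> n \<ge> M \<Longrightarrow> norm (X m - X n) < e"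
      unfolding Cauchy_def dist_norm by metis
    have "L2_set (\<lambda>i. norm (ell2_nth (X m) i - y i)) {..<k} \<le> e" if "m \<ge> M" for m k
    proof (rule tendsto_upperbound)
      show "(\<lambda>n. L2_set (\<lambda>i. norm (ell2_nth (X m) i - ell2_nth (X n) i)) {..<k})
          \<longlonglongrightarrow> L2_set (\<lambda>i. norm (ell2_nth (X m) i - y i)) {..<k}"
        unfolding L2_set_def by (intro tendsto_intros y)
      have "L2_set (\<lambda>i. norm (ell2_nth (X m) i - ell2_nth (X n) i)) {..<k} \<le> e" if "n \<ge> M" for n
        using L2_set_le_sqrt_suminf[OF summable_ell2[of "X m - X n"], of k]
          M[OF \<open>m \<ge> M\<close> that] by (simp add: norm_ell2.rep_eq ell2_nth_minus)
      then show "\<forall>\<^sub>F n in sequentially.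
          L2_set (\<lambda>i. norm (ell2_nth (X m) i - ell2_nth (X n) i)) {..<k} \<le> e"
        by (auto simp: eventually_sequentially)
    qed simp
    then show ?thesis by blast
  qed
  obtain M1 where "\<And>k. L2_set (\<lambda>i. norm (ell2_nth (X M1) i - y i)) {..<k} \<le> 1"
    using tail[of 1] by auto
  then have "summable (\<lambda>i. (norm (ell2_nth (X M1) i - y i))\<^sup>2)"
    by (rule square_summable_bounded)
  then have "summable (\<lambda>i. (norm (- (ell2_nth (X M1) i - y i) + ell2_nth (X M1) i))\<^sup>2)"
    by (intro square_summable_add(1) summable_ell2) (simp add: norm_minus_commute)
  then have sy: "summable (\<lambda>i. (norm (y i))\<^sup>2)" by simp
  define Y where "Y = Abs_ell2 y"
  have Y: "ell2_nth Y = y" unfolding Y_def using sy by (simp add: Abs_ell2_inverse)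
  have "X \<longlonglongrightarrow> Y"
    unfolding LIMSEQ_iff
  proof (intro allI impI)
    fix r :: real assume r: "0 < r"
    then obtain M where M: "\<And>m k. m \<ge> M \<Longrightarrow> L2_set (\<lambda>i. norm (ell2_nth (X m) i - y i)) {..<k} \<le> r / 2"
      using tail[of "r / 2"] by auto
    have "norm (X m - Y) \<le> r / 2" if "m \<ge> M" for m
      using square_summable_bounded(2)[OF M[OF that]]
      by (simp add: norm_ell2.rep_eq ell2_nth_minus Y)
    then show "\<exists>no. \<forall>n\<ge>no. norm (X n - Y) < r"
      using r by (intro exI[of _ M]) force
  qed
  then show "convergent X" by (auto simp: convergent_def)
qed

definition ell2_ip :: "'k::rc_field ell2 \<Rightarrow> 'k ell2 \<Rightarrow> 'k" where
  "ell2_ip x y = (\<Sum>n. ell2_nth x n * kcnj (ell2_nth y n))"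

lift_definition ell2_basis :: "nat \<Rightarrow> 'k::rc_field ell2" is "\<lambda>m n. if n = m then 1 else 0"
  subgoal for m by (rule summable_finite[of "{m}"]) auto
  done

lemma kcnj_zero: "kcnj (0::'k::rc_field) = 0"
  using kcnj_add[of "0::'k" 0] by simp

lemma norm_kcnj: "norm (kcnj x) = norm (x::'k::rc_field)"
proof (cases "x = 0")
  case False
  have "norm x * norm (kcnj x) = norm x * norm x"
    using arg_cong[OF mult_kcnj[of x], of norm]
    by (simp add: norm_mult power2_eq_square)
  with False show ?thesis by simp
qed (simp add: kcnj_zero)

lemma kcnj_of_real: "kcnj (of_real r :: 'k::rc_field) = of_real r"
proof (cases "r = 0")
  case False
  have "(of_real r :: 'k) * kcnj (of_real r) = of_real r * of_real r"
    using mult_kcnj[of "of_real r :: 'k"] by (simp add: power2_eq_square flip: of_real_mult)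
  with False show ?thesis by simp
qed (simp add: kcnj_zero)

lemma kcnj_kcnj: "kcnj (kcnj x) = (x::'k::rc_field)"
proof (cases "x = 0")
  case False
  then have "kcnj x \<noteq> 0" using norm_kcnj[of x] by auto
  moreover have "kcnj x * kcnj (kcnj x) = kcnj x * x"
    using mult_kcnj[of x] mult_kcnj[of "kcnj x"] by (simp add: norm_kcnj mult.commute)
  ultimately show ?thesis by simp
qed (simp add: kcnj_zero)

lemma bounded_linear_kcnj: "bounded_linear (kcnj :: 'k::rc_field \<Rightarrow> 'k)"
  by (rule bounded_linear_intro[of _ 1])
    (simp_all add: kcnj_add scaleR_conv_of_real kcnj_mult kcnj_of_real norm_kcnj)

lemma summable_ell2_ip: "summable (\<lambda>n. ell2_nth x n * kcnj (ell2_nth y n))"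
proof (rule summable_comparison_test'[of "\<lambda>n. (norm (ell2_nth x n))\<^sup>2 + (norm (ell2_nth y n))\<^sup>2" 0])
  show "summable (\<lambda>n. (norm (ell2_nth x n))\<^sup>2 + (norm (ell2_nth y n))\<^sup>2)"
    by (intro summable_add summable_ell2)
  fix n
  define a b where "a = norm (ell2_nth x n)" and "b = norm (ell2_nth y n)"
  have "2 * (a * b) \<le> a\<^sup>2 + b\<^sup>2" using sum_squares_bound[of a b] by simp
  moreover have "0 \<le> a * b" by (simp add: a_def b_def)
  ultimately have "a * b \<le> a\<^sup>2 + b\<^sup>2" by linarith
  then show "norm (ell2_nth x n * kcnj (ell2_nth y n)) \<le> (norm (ell2_nth x n))\<^sup>2 + (norm (ell2_nth y n))\<^sup>2"
    by (simp add: norm_mult norm_kcnj a_def b_def)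
qed

lemma hilbert_space_ell2: "hilbert_space (ell2_scale :: 'k::rc_field \<Rightarrow> _) ell2_ip"
proof
  fix a b c :: 'k and x y z :: "'k ell2" and r :: real
  show "ell2_scale a (x + y) = ell2_scale a x + ell2_scale a y"
    "ell2_scale (a + b) x = ell2_scale a x + ell2_scale b x"
    "ell2_scale a (ell2_scale b x) = ell2_scale (a * b) x"
    "ell2_scale 1 x = x"
    by (transfer; simp add: algebra_simps)+
  show "ell2_scale (of_real r) x = r *\<^sub>R x"
    by transfer (simp add: scaleR_conv_of_real)
  show "ell2_ip (x + y) z = ell2_ip x z + ell2_ip y z"
    unfolding ell2_ip_def
    by (simp add: plus_ell2.rep_eq distrib_right suminf_add[symmetric] summable_ell2_ip)
  show "ell2_ip (ell2_scale c x) z = c * ell2_ip x z"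
    unfolding ell2_ip_def
    by (simp add: ell2_scale.rep_eq mult.assoc suminf_mult summable_ell2_ip)
  show "ell2_ip y x = kcnj (ell2_ip x y)"
    unfolding ell2_ip_def
    by (simp add: bounded_linear.suminf[OF bounded_linear_kcnj summable_ell2_ip]
        kcnj_mult kcnj_kcnj mult.commute)
  show "ell2_ip x x = of_real ((norm x)\<^sup>2)"
    unfolding ell2_ip_def mult_kcnj
    by (simp add: norm_ell2.rep_eq suminf_nonneg summable_ell2 suminf_of_real[symmetric]
        del: of_real_power)
qed

definition coordinate_subspace :: "nat set \<Rightarrow> 'k::rc_field ell2 set" where
  "coordinate_subspace J = closed_span ell2_scale (ell2_basis ` J)"

text \<open>
  The bounded operator that maps the canonical basis to the frame. For a frame \<open>f\<close> it exists,
  because the upper frame bound gives boundedness, and it is unique, because the linear span of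
  the canonical basis is dense.
\<close>

definition synthesis_operator ::
    "('k::rc_field \<Rightarrow> 'a::banach \<Rightarrow> 'a) \<Rightarrow> (nat \<Rightarrow> 'a) \<Rightarrow> 'k ell2 \<Rightarrow> 'a" where
  "synthesis_operator scl f =
     (THE T. Vector_Spaces.linear ell2_scale scl T \<and> bounded_linear T \<and>
        (\<forall>n. T (ell2_basis n) = f n))"

definition nullspace :: "('a \<Rightarrow> 'b::zero) \<Rightarrow> 'a set" where
  "nullspace T = {x. T x = 0}"

end

theory Submission
  imports Defs
begin

text \<open>
  Let \<open>T\<close> be the synthesis operator, \<open>N\<close> its nullspace, and \<open>M\<^sub>J\<close> the coordinate subspace of an index
  set \<open>J\<close>. Both sides of the equivalence say the same thing about the exhausting sets \<open>J = I n\<close>: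
  there is one constant \<open>a > 0\<close> with \<open>a \<parallel>x\<parallel>\<^sup>2 \<le> \<parallel>T x\<parallel>\<^sup>2\<close> for every \<open>x \<in> M\<^sub>J\<close> orthogonal to \<open>N \<inter> M\<^sub>J\<close>.

  For the frame sequences, the reason is duality. The analysis operator \<open>g \<mapsto> (\<langle>g, f n\<rangle>)\<close>, cut off
  outside \<open>J\<close>, is the adjoint of \<open>T\<close> restricted to \<open>M\<^sub>J\<close>, and the lower frame inequality bounds it from
  below on the closed span of the \<open>f n\<close> with \<open>n \<in> J\<close>. An operator is bounded below on the orthogonal
  complement of its kernel iff its adjoint is bounded below on the closure of the operator's range, with
  the same constant; the two directions are \<open>synth_lower_bound_of_frame_bound\<close> and
  \<open>frame_bound_of_synth_lower_bound\<close>.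

  For the angles, the reason is that \<open>\<parallel>T x\<parallel>\<close> is comparable to the distance from \<open>x\<close> to \<open>N\<close>: the
  upper estimate is the boundedness of \<open>T\<close>, and the lower one is the duality above for the whole frame,
  with \<open>J\<close> all of \<open>\<nat>\<close>. The cosine \<open>c\<close> of the angle between \<open>N\<close> and \<open>M\<^sub>J\<close> bounds the length of the
  projection to \<open>N\<close> of a vector \<open>x\<close> as above by \<open>c \<parallel>x\<parallel>\<close>, so by Pythagoras that distance is
  at least \<open>sqrt (1 - c\<^sup>2) \<parallel>x\<parallel>\<close>; conversely a lower bound on the distance limits the cosine. This is
  \<open>synth_lower_bound_of_angle_cos\<close> and \<open>angle_cos_le_of_synth_lower_bound\<close>.

  The upper frame bound of the whole frame serves for every subfamily.
\<close>

section \<open>Orthogonality and projections in Hilbert space\<close>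

context hilbert_space
begin

lemma ip_add_right: "ip x (y + z) = ip x y + ip x z"
  by (metis ip_commute ip_add_left kcnj_add)

lemma ip_scale_right: "ip x (scl c y) = kcnj c * ip x y"
  by (metis ip_commute ip_scale_left kcnj_mult)

lemma ip_diff_left: "ip (x - y) z = ip x z - ip y z"
  using ip_add_left[of "x - y" y z] by (simp add: algebra_simps)

lemma ip_diff_right: "ip x (y - z) = ip x y - ip x z"
  using ip_add_right[of x "y - z" z] by (simp add: algebra_simps)

lemma ip_zero_left [simp]: "ip 0 x = 0"
  using ip_diff_left[of 0 0 x] by simp

lemma ip_zero_right [simp]: "ip x 0 = 0"
  using ip_diff_right[of x 0 0] by simp

lemma norm_ip_commute: "norm (ip x y) = norm (ip y x)"
  by (metis ip_commute norm_kcnj)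

lemma ip_eq_0_commute: "ip x y = 0 \<longleftrightarrow> ip y x = 0"
  by (metis norm_ip_commute norm_eq_zero)

lemma ip_self_eq_0 [simp]: "ip x x = 0 \<longleftrightarrow> x = 0"
  by (simp add: ip_self)

lemma norm_ip_self: "norm (ip x x) = (norm x)\<^sup>2"
  by (simp add: ip_self norm_power)

lemma norm_scl: "norm (scl c x) = norm c * norm x"
proof -
  have "(norm (scl c x))\<^sup>2 = norm (ip (scl c x) (scl c x))"
    by (simp add: norm_ip_self)
  also have "\<dots> = (norm c * norm x)\<^sup>2"
    by (simp add: ip_scale_left ip_scale_right norm_mult norm_kcnj norm_ip_self power2_eq_square)
  finally show ?thesis by simp
qed

lemma pythagoras:
  assumes "ip (x - y) y = 0"
  shows "(norm x)\<^sup>2 = (norm (x - y))\<^sup>2 + (norm y)\<^sup>2"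
proof -
  have "ip y (x - y) = 0" using assms ip_eq_0_commute by blast
  then have "ip x x = ip (x - y) (x - y) + ip y y"
    using assms by (simp add: ip_diff_left ip_diff_right algebra_simps)
  then have "(of_real ((norm x)\<^sup>2) :: 'k) = of_real ((norm (x - y))\<^sup>2 + (norm y)\<^sup>2)"
    by (simp only: ip_self of_real_add)
  then show ?thesis by (simp only: of_real_eq_iff)
qed

lemma parallelogram:
  fixes x y :: 'a
  shows "(norm (x + y))\<^sup>2 + (norm (x - y))\<^sup>2 = 2 * (norm x)\<^sup>2 + 2 * (norm y)\<^sup>2"
proof -
  have "ip (x + y) (x + y) + ip (x - y) (x - y) = 2 * ip x x + 2 * ip y y"
    by (simp add: ip_add_left ip_add_right ip_diff_left ip_diff_right)
  then have "(of_real ((norm (x + y))\<^sup>2 + (norm (x - y))\<^sup>2) :: 'k)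
      = of_real (2 * (norm x)\<^sup>2 + 2 * (norm y)\<^sup>2)"
    by (simp only: ip_self of_real_add of_real_mult of_real_numeral)
  then show ?thesis by (simp only: of_real_eq_iff)
qed

text \<open>
  The vector subtracted is the component of \<open>x\<close> along \<open>v\<close>. The formula yields the Cauchy-Schwarz
  inequality and measures by how much the distance to a subspace can be improved in the direction \<open>v\<close>.
\<close>

lemma norm_sq_residual:
  assumes "v \<noteq> 0"
  shows "(norm (x - scl (ip x v / of_real ((norm v)\<^sup>2)) v))\<^sup>2
    = (norm x)\<^sup>2 - (norm (ip x v))\<^sup>2 / (norm v)\<^sup>2"
proof -
  let ?t = "ip x v / of_real ((norm v)\<^sup>2)"
  have "ip (x - scl ?t v) (scl ?t v) = 0"
    using assms by (simp add: ip_diff_left ip_scale_left ip_scale_right ip_self)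
  from pythagoras[OF this]
  have "(norm x)\<^sup>2 = (norm (x - scl ?t v))\<^sup>2 + (norm ?t * norm v)\<^sup>2"
    by (simp add: norm_scl)
  moreover have "(norm ?t * norm v)\<^sup>2 = (norm (ip x v))\<^sup>2 / (norm v)\<^sup>2"
    using assms by (simp add: norm_divide norm_mult power2_eq_square)
  ultimately show ?thesis by simp
qed

lemma cauchy_schwarz: "norm (ip x y) \<le> norm x * norm y"
proof (cases "y = 0")
  case False
  have "0 \<le> (norm x)\<^sup>2 - (norm (ip x y))\<^sup>2 / (norm y)\<^sup>2"
    unfolding norm_sq_residual[OF False, symmetric] by simp
  then have "(norm (ip x y))\<^sup>2 \<le> (norm x * norm y)\<^sup>2"
    using False by (simp add: field_simps)
  then show ?thesis by (rule power2_le_imp_le) simp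
qed simp

lemma bounded_linear_scl: "bounded_linear (scl c)"
proof (rule bounded_linear_intro)
  show "scl c (r *\<^sub>R x) = r *\<^sub>R scl c x" for r x
    by (simp flip: scale_of_real add: mult.commute)
  show "norm (scl c x) \<le> norm x * norm c" for x
    by (simp add: norm_scl)
qed (rule scale_right_distrib)

lemma bounded_linear_ip_left: "bounded_linear (\<lambda>x. ip x z)"
proof (rule bounded_linear_intro)
  show "ip (r *\<^sub>R x) z = r *\<^sub>R ip x z" for r x
    by (simp flip: scale_of_real add: ip_scale_left scaleR_conv_of_real)
qed (auto intro: ip_add_left cauchy_schwarz)

lemma subspace_closure:
  assumes "subspace V"
  shows "subspace (closure V)"
proof (rule subspaceI)
  show "0 \<in> closure V"
    using subspace_0[OF assms] closure_subset by blast
  show "x + y \<in> closure V" if "x \<in> closure V" "y \<in> closure V" for x y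
  proof -
    from that obtain u v where "\<And>n. u n \<in> V" "u \<longlonglongrightarrow> x" "\<And>n. v n \<in> V" "v \<longlonglongrightarrow> y"
      unfolding closure_sequential by blast
    then show ?thesis
      unfolding closure_sequential
      by (intro exI[of _ "\<lambda>n. u n + v n"]) (auto intro: tendsto_add subspace_add[OF assms])
  qed
  show "scl c x \<in> closure V" if "x \<in> closure V" for c x
  proof -
    have "scl c ` closure V \<subseteq> closure (scl c ` V)"
      by (rule closure_bounded_linear_image_subset[OF bounded_linear_scl])
    also have "\<dots> \<subseteq> closure V"
      by (intro closure_mono) (auto intro: subspace_scale[OF assms])
    finally show ?thesis using that by blast
  qed
qed

text \<open>
  The point of \<open>V\<close> closest to \<open>x\<close>. It is found as the common point of the sets of near-minimizers,
  whose diameters shrink by the parallelogram law; the residual is orthogonal to \<open>V\<close>, since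
  removing its component along some \<open>v \<in> V\<close> would bring it still closer.
\<close>

lemma orthogonal_projection_exists:
  assumes V: "subspace V" and "closed V"
  obtains p where "p \<in> V" and "\<And>v. v \<in> V \<Longrightarrow> ip (x - p) v = 0"
proof -
  define d where "d = (INF v\<in>V. (norm (x - v))\<^sup>2)"
  define S where "S n = {v \<in> V. (norm (x - v))\<^sup>2 \<le> d + inverse (real (Suc n))}" for n
  have bdd: "bdd_below ((\<lambda>v. (norm (x - v))\<^sup>2) ` V)" by (rule bdd_belowI2[of _ 0]) simp
  have d_le: "d \<le> (norm (x - v))\<^sup>2" if "v \<in> V" for v
    unfolding d_def using that bdd by (rule cINF_lower[rotated])
  have V_ne: "V \<noteq> {}" using subspace_0[OF V] by blast
  have "closed (S n)" for n
  proof -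
    have "S n = V \<inter> {v. (norm (x - v))\<^sup>2 \<le> d + inverse (real (Suc n))}" by (auto simp: S_def)
    then show ?thesis using \<open>closed V\<close>
      by (auto intro!: closed_Int closed_Collect_le continuous_intros)
  qed
  moreover have "S n \<noteq> {}" for n
  proof -
    have "d < d + inverse (real (Suc n))" by simp
    then obtain v where "v \<in> V" "(norm (x - v))\<^sup>2 < d + inverse (real (Suc n))"
      unfolding d_def cINF_less_iff[OF V_ne bdd] by blast
    then show ?thesis by (auto simp: S_def intro!: exI[of _ v])
  qed
  moreover have "S n \<subseteq> S m" if "m \<le> n" for m n
    using that by (auto simp: S_def intro: order_trans add_left_mono le_imp_inverse_le)
  moreover have "\<exists>n. \<forall>u\<in>S n. \<forall>v\<in>S n. dist u v < e" if "0 < e" for e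
  proof -
    obtain n where n: "inverse (real (Suc n)) < e\<^sup>2 / 4"
      using reals_Archimedean[of "e\<^sup>2 / 4"] \<open>0 < e\<close> by auto
    have "dist u v < e" if "u \<in> S n" "v \<in> S n" for u v
    proof -
      \<comment> \<open>The midpoint lies in \<open>V\<close>, so its distance to \<open>x\<close> bounds one diagonal of the
        parallelogram from below, which leaves little length for the other diagonal \<open>u - v\<close>.\<close>
      define w where "w = (1/2) *\<^sub>R (u + v)"
      have "w \<in> V"
        using that V unfolding w_def S_def scale_of_real[symmetric]
        by (auto intro: subspace_scale subspace_add)
      then have "4 * d \<le> (norm (2 *\<^sub>R (x - w)))\<^sup>2"
        using d_le[of w] by (simp add: power_mult_distrib)
      moreover have "2 *\<^sub>R (x - w) = (x - u) + (x - v)"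
        by (simp add: w_def algebra_simps scaleR_2)
      moreover have "(norm (x - u))\<^sup>2 \<le> d + inverse (real (Suc n))"
        "(norm (x - v))\<^sup>2 \<le> d + inverse (real (Suc n))"
        using that by (auto simp: S_def)
      ultimately have "(norm ((x - u) - (x - v)))\<^sup>2 < e\<^sup>2"
        using parallelogram[of "x - u" "x - v"] n by simp
      then have "norm ((x - u) - (x - v)) < e"
        using \<open>0 < e\<close> by (meson less_imp_le power2_less_imp_less)
      then show ?thesis by (simp add: dist_norm norm_minus_commute)
    qed
    then show ?thesis by blast
  qed
  ultimately obtain p where p: "\<And>n. p \<in> S n"
    using decreasing_closed_nest[of S] by metis
  then have "p \<in> V" by (auto simp: S_def)
  have le_d: "(norm (x - p))\<^sup>2 \<le> d"
  proof (rule field_le_epsilon)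
    fix e :: real assume "0 < e"
    then obtain n where "inverse (real (Suc n)) < e" using reals_Archimedean by blast
    then show "(norm (x - p))\<^sup>2 \<le> d + e" using p[of n] by (simp add: S_def)
  qed
  have "ip (x - p) v = 0" if "v \<in> V" for v
  proof (cases "v = 0")
    case False
    let ?t = "ip (x - p) v / of_real ((norm v)\<^sup>2)"
    have "d \<le> (norm (x - (p + scl ?t v)))\<^sup>2"
      using \<open>p \<in> V\<close> that V by (intro d_le) (auto intro: subspace_add subspace_scale)
    also have "\<dots> = (norm (x - p))\<^sup>2 - (norm (ip (x - p) v))\<^sup>2 / (norm v)\<^sup>2"
      using norm_sq_residual[OF False, of "x - p"] by (simp add: diff_diff_eq)
    finally have "(norm (ip (x - p) v))\<^sup>2 / (norm v)\<^sup>2 \<le> 0" using le_d by simp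
    then show ?thesis using False by (simp add: divide_le_0_iff)
  qed simp
  with \<open>p \<in> V\<close> show ?thesis using that by blast
qed

lemma
  shows angle_cos_nonneg: "0 \<le> angle_cos ip M N"
    and angle_cos_le_1: "angle_cos ip M N \<le> 1"
    and norm_ip_le_angle_cos_unit:
      "\<lbrakk>x \<in> M \<inter> orth_complement ip (M \<inter> N); y \<in> N \<inter> orth_complement ip (M \<inter> N);
        norm x = 1; norm y = 1\<rbrakk> \<Longrightarrow> norm (ip x y) \<le> angle_cos ip M N"
proof -
  let ?S = "insert 0 {norm (ip x y) | x y.
    x \<in> M \<inter> orth_complement ip (M \<inter> N) \<and> y \<in> N \<inter> orth_complement ip (M \<inter> N) \<and>
    norm x = 1 \<and> norm y = 1}"
  have le_1: "t \<le> 1" if "t \<in> ?S" for t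
    using that cauchy_schwarz by (auto, metis mult_1)
  then have upper: "t \<le> angle_cos ip M N" if "t \<in> ?S" for t
    unfolding angle_cos_def using that by (intro cSup_upper bdd_aboveI[of _ 1])
  show "0 \<le> angle_cos ip M N" by (rule upper) simp
  show "angle_cos ip M N \<le> 1"
    unfolding angle_cos_def using le_1 by (intro cSup_least) auto
  show "norm (ip x y) \<le> angle_cos ip M N"
    if "x \<in> M \<inter> orth_complement ip (M \<inter> N)" "y \<in> N \<inter> orth_complement ip (M \<inter> N)"
      "norm x = 1" "norm y = 1"
    by (rule upper) (use that in blast)
qed

lemma norm_ip_le_angle_cos:
  assumes M: "subspace M" and N: "subspace N"
    and x: "x \<in> M" "x \<in> orth_complement ip (M \<inter> N)"
    and y: "y \<in> N" "y \<in> orth_complement ip (M \<inter> N)"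
  shows "norm (ip x y) \<le> angle_cos ip M N * (norm x * norm y)"
proof (cases "x = 0 \<or> y = 0")
  case False
  define u v where "u = scl (of_real (inverse (norm x))) x"
    and "v = scl (of_real (inverse (norm y))) y"
  have "norm u = 1" "norm v = 1"
    using False by (auto simp: u_def v_def norm_scl simp del: of_real_inverse)
  moreover have "u \<in> M \<inter> orth_complement ip (M \<inter> N)" "v \<in> N \<inter> orth_complement ip (M \<inter> N)"
    using x y M N by (auto simp: u_def v_def orth_complement_def ip_scale_left intro: subspace_scale)
  ultimately have "norm (ip u v) \<le> angle_cos ip M N"
    by (intro norm_ip_le_angle_cos_unit)
  moreover have "norm (ip u v) = norm (ip x y) / (norm x * norm y)"
    by (simp add: u_def v_def ip_scale_left ip_scale_right norm_mult norm_kcnj divide_inverse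
        mult_ac norm_inverse del: of_real_inverse)
  ultimately show ?thesis using False by (simp add: field_simps)
qed auto

end

interpretation ell2: hilbert_space "ell2_scale :: 'k::rc_field \<Rightarrow> _" ell2_ip
  by (rule hilbert_space_ell2)


section \<open>Synthesis and analysis for Bessel sequences\<close>

locale bessel_sequence = hilbert_space scl ip
  for scl :: "'k::rc_field \<Rightarrow> 'h::banach \<Rightarrow> 'h" and ip +
  fixes f :: "nat \<Rightarrow> 'h" and B :: real
  assumes B_pos: "0 < B"
    and summable_bessel: "summable (\<lambda>n. (norm (ip g (f n)))\<^sup>2)"
    and bessel_bound: "(\<Sum>n. (norm (ip g (f n)))\<^sup>2) \<le> B * (norm g)\<^sup>2"
begin

text \<open>
  Testing the sum against itself, say \<open>g = \<Sum> c n f n\<close>, gives \<open>\<parallel>g\<parallel>\<^sup>2 = \<Sum> c n \<langle>f n, g\<rangle>\<close>; the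
  Cauchy-Schwarz inequality for sums and the Bessel bound for \<open>g\<close> then leave a single factor \<open>\<parallel>g\<parallel>\<close>
  on the right, which cancels.
\<close>

lemma norm_sum_scl_le:
  assumes "finite F"
  shows "norm (\<Sum>n\<in>F. scl (c n) (f n)) \<le> sqrt B * L2_set (\<lambda>n. norm (c n)) F"
proof -
  define g where "g = (\<Sum>n\<in>F. scl (c n) (f n))"
  have "(norm g)\<^sup>2 = norm (ip g g)" by (simp add: norm_ip_self)
  also have "ip g g = (\<Sum>n\<in>F. c n * ip (f n) g)"
    by (subst g_def)
      (simp add: linear_sum[OF bounded_linear.linear[OF bounded_linear_ip_left]] ip_scale_left)
  also have "norm \<dots> \<le> (\<Sum>n\<in>F. \<bar>norm (c n)\<bar> * \<bar>norm (ip g (f n))\<bar>)"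
    by (rule sum_norm_le) (simp add: norm_mult norm_ip_commute)
  also have "\<dots> \<le> L2_set (\<lambda>n. norm (c n)) F * L2_set (\<lambda>n. norm (ip g (f n))) F"
    by (rule L2_set_mult_ineq)
  also have "\<dots> \<le> L2_set (\<lambda>n. norm (c n)) F * (sqrt B * norm g)"
  proof (rule mult_left_mono)
    have "(\<Sum>n\<in>F. (norm (ip g (f n)))\<^sup>2) \<le> (\<Sum>n. (norm (ip g (f n)))\<^sup>2)"
      by (rule sum_le_suminf[OF summable_bessel \<open>finite F\<close>]) simp
    also note bessel_bound
    finally show "L2_set (\<lambda>n. norm (ip g (f n))) F \<le> sqrt B * norm g"
      unfolding L2_set_def by (metis norm_ge_zero real_sqrt_abs2 real_sqrt_le_mono real_sqrt_mult
          abs_of_nonneg power2_eq_square)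
  qed (rule L2_set_nonneg)
  finally have *: "norm g * norm g \<le> (sqrt B * L2_set (\<lambda>n. norm (c n)) F) * norm g"
    by (simp add: power2_eq_square mult_ac)
  show ?thesis
    using * B_pos unfolding g_def[symmetric]
    by (cases "g = 0") (auto simp: mult_le_cancel_right L2_set_nonneg)
qed

lemma summable_synthesis: "summable (\<lambda>n. scl (ell2_nth x n) (f n))"
  unfolding summable_Cauchy
proof (intro allI impI)
  fix e :: real assume "0 < e"
  then have "0 < e\<^sup>2 / B" using B_pos by simp
  with summable_ell2[of x, unfolded summable_Cauchy] obtain N where
    N: "\<And>m n. m \<ge> N \<Longrightarrow> norm (\<Sum>i\<in>{m..<n}. (norm (ell2_nth x i))\<^sup>2) < e\<^sup>2 / B"
    by blast
  have "norm (\<Sum>i\<in>{m..<n}. scl (ell2_nth x i) (f i)) < e" if "m \<ge> N" for m n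
  proof -
    have "norm (\<Sum>i\<in>{m..<n}. scl (ell2_nth x i) (f i))
        \<le> sqrt (B * (\<Sum>i\<in>{m..<n}. (norm (ell2_nth x i))\<^sup>2))"
      using norm_sum_scl_le[of "{m..<n}" "ell2_nth x"] by (simp add: L2_set_def real_sqrt_mult)
    also have "\<dots> < sqrt (e\<^sup>2)"
      using N[OF that, of n] B_pos
      by (intro real_sqrt_less_mono) (simp add: abs_less_iff field_simps)
    finally show ?thesis using \<open>0 < e\<close> by simp
  qed
  then show "\<exists>N. \<forall>m\<ge>N. \<forall>n. norm (\<Sum>i\<in>{m..<n}. scl (ell2_nth x i) (f i)) < e" by blast
qed

lemma norm_suminf_scl_le: "norm (\<Sum>n. scl (ell2_nth x n) (f n)) \<le> sqrt B * norm x"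
proof (rule LIMSEQ_le_const2)
  show "(\<lambda>k. norm (\<Sum>n<k. scl (ell2_nth x n) (f n))) \<longlonglongrightarrow> norm (\<Sum>n. scl (ell2_nth x n) (f n))"
    by (intro tendsto_norm summable_LIMSEQ summable_synthesis)
  have "norm (\<Sum>n<k. scl (ell2_nth x n) (f n)) \<le> sqrt B * norm x" for k
  proof -
    have "L2_set (\<lambda>n. norm (ell2_nth x n)) {..<k} \<le> norm x"
      unfolding norm_ell2.rep_eq by (rule L2_set_le_sqrt_suminf[OF summable_ell2])
    then show ?thesis
      using B_pos
      by (intro order_trans[OF norm_sum_scl_le[of "{..<k}" "ell2_nth x"]] mult_left_mono) auto
  qed
  then show "\<exists>N. \<forall>k\<ge>N. norm (\<Sum>n<k. scl (ell2_nth x n) (f n)) \<le> sqrt B * norm x" by blast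
qed

end

lemma norm_ell2_sq: "(norm x)\<^sup>2 = (\<Sum>n. (norm (ell2_nth x n))\<^sup>2)"
  by (simp add: norm_ell2.rep_eq suminf_nonneg summable_ell2)

lemma ell2_ip_basis: "ell2_ip x (ell2_basis n) = ell2_nth x n"
proof -
  have "(\<lambda>m. ell2_nth x m * kcnj (ell2_nth (ell2_basis n) m))
      = (\<lambda>m. if m = n then ell2_nth x n else 0)"
    using kcnj_of_real[of 1, where ?'k = 'a] by (auto simp: ell2_basis.rep_eq kcnj_zero)
  then show ?thesis
    unfolding ell2_ip_def using sums_unique[OF sums_single[of n "\<lambda>_. ell2_nth x n"]] by simp
qed

lemma bounded_linear_ell2_nth: "bounded_linear (\<lambda>x. ell2_nth x n)"
  using ell2.bounded_linear_ip_left[of "ell2_basis n"] by (simp add: ell2_ip_basis)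

text \<open>
  The canonical basis is itself a Bessel sequence with bound \<open>1\<close>, so its expansions converge by
  the general result; the limit is then identified coordinatewise.
\<close>

lemma ell2_basis_sums: "(\<lambda>n. ell2_scale (ell2_nth x n) (ell2_basis n)) sums (x :: 'k::rc_field ell2)"
proof -
  have "bessel_sequence (ell2_scale :: 'k \<Rightarrow> _) ell2_ip ell2_basis 1"
    by (intro bessel_sequence.intro hilbert_space_ell2 bessel_sequence_axioms.intro)
      (simp_all add: ell2_ip_basis summable_ell2 norm_ell2_sq)
  then have s: "summable (\<lambda>n. ell2_scale (ell2_nth x n) (ell2_basis n))"
    by (rule bessel_sequence.summable_synthesis)
  have "(\<Sum>n. ell2_scale (ell2_nth x n) (ell2_basis n)) = x"
  proof (rule ell2_eqI)
    fix i
    have "ell2_nth (\<Sum>n. ell2_scale (ell2_nth x n) (ell2_basis n)) i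
        = (\<Sum>n. ell2_nth (ell2_scale (ell2_nth x n) (ell2_basis n)) i)"
      by (rule bounded_linear.suminf[OF bounded_linear_ell2_nth s])
    also have "\<dots> = (\<Sum>n. if n = i then ell2_nth x n else 0)"
      by (rule arg_cong[of _ _ suminf]) (auto simp: ell2_scale.rep_eq ell2_basis.rep_eq)
    also have "\<dots> = ell2_nth x i"
      by (rule sums_unique[OF sums_single, symmetric])
    finally show "ell2_nth (\<Sum>n. ell2_scale (ell2_nth x n) (ell2_basis n)) i = ell2_nth x i" .
  qed
  with s show ?thesis by (simp add: sums_iff)
qed

lemma subspace_supported: "ell2.subspace {x. \<forall>n. n \<notin> J \<longrightarrow> ell2_nth x n = 0}"
  by (rule ell2.subspaceI) (auto simp: zero_ell2.rep_eq plus_ell2.rep_eq ell2_scale.rep_eq)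

lemma coordinate_subspace_eq:
  "coordinate_subspace J = {x. \<forall>n. n \<notin> J \<longrightarrow> ell2_nth x n = 0}"
proof
  have "closed {x :: 'a ell2. ell2_nth x n = 0}" for n
    by (intro closed_Collect_eq continuous_on_const
        bounded_linear.continuous_on[OF bounded_linear_ell2_nth] continuous_on_id)
  then have "closed {x :: 'a ell2. \<forall>n. n \<notin> J \<longrightarrow> ell2_nth x n = 0}"
    by (intro closed_Collect_all closed_Collect_imp) auto
  moreover have "ell2.span (ell2_basis ` J) \<subseteq> {x. \<forall>n. n \<notin> J \<longrightarrow> ell2_nth x n = 0}"
    by (intro ell2.span_minimal subspace_supported) (auto simp: ell2_basis.rep_eq)
  ultimately show "coordinate_subspace J \<subseteq> {x :: 'a ell2. \<forall>n. n \<notin> J \<longrightarrow> ell2_nth x n = 0}"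
    unfolding coordinate_subspace_def closed_span_def by (rule closure_minimal[rotated])
  show "{x :: 'a ell2. \<forall>n. n \<notin> J \<longrightarrow> ell2_nth x n = 0} \<subseteq> coordinate_subspace J"
  proof
    fix x :: "'a ell2"
    assume x: "x \<in> {x. \<forall>n. n \<notin> J \<longrightarrow> ell2_nth x n = 0}"
    have "ell2_scale (ell2_nth x n) (ell2_basis n) \<in> ell2.span (ell2_basis ` J)" for n
      using x by (cases "n \<in> J") (auto intro: ell2.span_scale ell2.span_base ell2.span_zero)
    then have "(\<Sum>n<k. ell2_scale (ell2_nth x n) (ell2_basis n)) \<in> ell2.span (ell2_basis ` J)" for k
      by (intro ell2.span_sum)
    then show "x \<in> coordinate_subspace J"
      unfolding coordinate_subspace_def closed_span_def closure_sequential
      using ell2_basis_sums[of x, unfolded sums_def]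
      by (intro exI[of _ "\<lambda>k. \<Sum>n<k. ell2_scale (ell2_nth x n) (ell2_basis n)"]) simp
  qed
qed

lemma closed_coordinate_subspace: "closed (coordinate_subspace J)"
  by (simp add: coordinate_subspace_def closed_span_def)

lemma subspace_coordinate_subspace: "ell2.subspace (coordinate_subspace J)"
  by (simp add: coordinate_subspace_eq subspace_supported)

lemma coordinate_subspace_UNIV: "coordinate_subspace UNIV = UNIV"
  by (simp add: coordinate_subspace_eq)

context bessel_sequence
begin

abbreviation "synth \<equiv> synthesis_operator scl f"
abbreviation "series x \<equiv> \<Sum>n. scl (ell2_nth x n) (f n)"

lemma series_properties:
  shows linear_series: "Vector_Spaces.linear ell2_scale scl (\<lambda>x. series x)"
    and bounded_linear_series: "bounded_linear (\<lambda>x. series x)"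
    and series_basis: "series (ell2_basis n) = f n"
proof -
  have add: "series (x + y) = series x + series y" for x y
    by (simp add: plus_ell2.rep_eq scale_left_distrib suminf_add summable_synthesis)
  have scl: "series (ell2_scale c x) = scl c (series x)" for c x
    using bounded_linear.suminf[OF bounded_linear_scl summable_synthesis]
    by (simp add: ell2_scale.rep_eq)
  have "series (r *\<^sub>R x) = r *\<^sub>R series x" for r x
    by (simp only: ell2.scale_of_real[symmetric] scale_of_real[symmetric] scl)
  moreover have "norm (series x) \<le> norm x * sqrt B" for x
    using norm_suminf_scl_le[of x] by (simp add: mult.commute)
  ultimately show "bounded_linear (\<lambda>x. series x)"
    by (intro bounded_linear_intro[of _ "sqrt B"] add)
  have "(\<lambda>m. scl (ell2_nth (ell2_basis n) m) (f m)) = (\<lambda>m. if m = n then f m else 0)"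
    by (auto simp: ell2_basis.rep_eq)
  then show "series (ell2_basis n) = f n"
    using sums_unique[OF sums_single[of n f]] by simp
  show "Vector_Spaces.linear ell2_scale scl (\<lambda>x. series x)"
    unfolding Vector_Spaces.linear_iff
    by (intro conjI allI add scl ell2.vector_space_axioms vector_space_axioms)
qed

text \<open>
  The definite description is met by the series, and by nothing else: a bounded linear operator can be
  applied termwise to the expansion of \<open>x\<close> in the canonical basis.
\<close>

lemma synthesis_operator_eq: "synth = (\<lambda>x. series x)"
  unfolding synthesis_operator_def
proof (rule the_equality)
  fix T assume T: "Vector_Spaces.linear ell2_scale scl T \<and> bounded_linear T \<and>
      (\<forall>n. T (ell2_basis n) = f n)"
  show "T = (\<lambda>x. series x)"
  proof
    fix x
    have "T (\<Sum>n. ell2_scale (ell2_nth x n) (ell2_basis n))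
        = (\<Sum>n. T (ell2_scale (ell2_nth x n) (ell2_basis n)))"
      using T ell2_basis_sums sums_summable by (blast intro: bounded_linear.suminf)
    then show "T x = series x"
      using T sums_unique[OF ell2_basis_sums[of x]] by (simp add: Vector_Spaces.linear_iff)
  qed
qed (use series_properties in blast)

lemma linear_synth: "Vector_Spaces.linear ell2_scale scl synth"
  and bounded_linear_synth: "bounded_linear synth"
  and synth_basis: "synth (ell2_basis n) = f n"
  unfolding synthesis_operator_eq by (fact series_properties)+

lemma norm_synth_le: "norm (synth x) \<le> sqrt B * norm x"
  by (simp add: synthesis_operator_eq norm_suminf_scl_le)

lemma subspace_nullspace_synth: "ell2.subspace (nullspace synth)"
  using linear_synth
  by (intro ell2.subspaceI) (auto simp: nullspace_def Vector_Spaces.linear_iff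
      linear_0[OF bounded_linear.linear[OF bounded_linear_synth]])

lemma closed_nullspace_synth: "closed (nullspace synth)"
  unfolding nullspace_def
  by (intro closed_Collect_eq continuous_on_const
      bounded_linear.continuous_on[OF bounded_linear_synth] continuous_on_id)

lemma synth_diff: "synth (x - y) = synth x - synth y"
  by (rule linear_diff[OF bounded_linear.linear[OF bounded_linear_synth]])

text \<open>
  The coefficients outside \<open>J\<close> are set to \<open>0\<close> instead of being dropped, so that the operators for all
  \<open>J\<close> have values in one Hilbert space and frame inequalities become inequalities between norms.
\<close>

definition analysis :: "nat set \<Rightarrow> 'h \<Rightarrow> 'k ell2" where
  "analysis J g = Abs_ell2 (\<lambda>n. if n \<in> J then ip g (f n) else 0)"

lemma nth_analysis: "ell2_nth (analysis J g) n = (if n \<in> J then ip g (f n) else 0)"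
proof -
  have "summable (\<lambda>n. (norm (if n \<in> J then ip g (f n) else 0))\<^sup>2)"
    by (rule summable_comparison_test'[OF summable_bessel[of g], of 0]) auto
  then show ?thesis
    unfolding analysis_def by (subst Abs_ell2_inverse) auto
qed

lemma analysis_in_coordinate_subspace: "analysis J g \<in> coordinate_subspace J"
  by (simp add: coordinate_subspace_eq nth_analysis)

lemma norm_analysis_sq_le: "(norm (analysis J g))\<^sup>2 \<le> B * (norm g)\<^sup>2"
proof -
  have "(norm (analysis J g))\<^sup>2 \<le> (\<Sum>n. (norm (ip g (f n)))\<^sup>2)"
    unfolding norm_ell2_sq
    by (intro suminf_le summable_ell2 summable_bessel) (simp add: nth_analysis)
  also note bessel_bound
  finally show ?thesis .
qed

lemma bounded_linear_analysis: "bounded_linear (analysis J)"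
proof (rule bounded_linear_intro)
  show "analysis J (g + h) = analysis J g + analysis J h" for g h
    by (rule ell2_eqI) (simp add: nth_analysis plus_ell2.rep_eq ip_add_left)
  show "analysis J (r *\<^sub>R g) = r *\<^sub>R analysis J g" for r g
    by (rule ell2_eqI) (simp add: nth_analysis scaleR_ell2.rep_eq ip_scale_left scaleR_conv_of_real
        flip: scale_of_real)
  show "norm (analysis J g) \<le> norm g * sqrt B" for g
    using real_sqrt_le_mono[OF norm_analysis_sq_le[of J g]] by (simp add: real_sqrt_mult mult.commute)
qed

lemma subspace_analysis_image:
  assumes "subspace V"
  shows "ell2.subspace (analysis J ` V)"
proof (rule ell2.subspaceI)
  show "0 \<in> analysis J ` V"
    using subspace_0[OF assms]
    by (intro image_eqI[of _ _ 0])
      (simp_all add: linear_0[OF bounded_linear.linear[OF bounded_linear_analysis]])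
  show "x + y \<in> analysis J ` V" if "x \<in> analysis J ` V" "y \<in> analysis J ` V" for x y
  proof -
    from that obtain g h where "g \<in> V" "h \<in> V" "x = analysis J g" "y = analysis J h" by blast
    then show ?thesis
      using subspace_add[OF assms, of g h]
      by (intro image_eqI[of _ _ "g + h"])
        (simp_all add: linear_add[OF bounded_linear.linear[OF bounded_linear_analysis]])
  qed
  show "ell2_scale c x \<in> analysis J ` V" if "x \<in> analysis J ` V" for c x
  proof -
    from that obtain g where "g \<in> V" "x = analysis J g" by blast
    then have "ell2_scale c x = analysis J (scl c g)"
      by (intro ell2_eqI) (simp add: nth_analysis ell2_scale.rep_eq ip_scale_left)
    then show ?thesis using \<open>g \<in> V\<close> subspace_scale[OF assms] by blast
  qed
qed

lemma ip_synth:
  assumes "x \<in> coordinate_subspace J"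
  shows "ip (synth x) g = ell2_ip x (analysis J g)"
proof -
  have "ip (synth x) g = (\<Sum>n. ip (scl (ell2_nth x n) (f n)) g)"
    unfolding synthesis_operator_eq
    by (rule bounded_linear.suminf[OF bounded_linear_ip_left summable_synthesis])
  also have "\<dots> = ell2_ip x (analysis J g)"
    unfolding ell2_ip_def using assms
    by (intro arg_cong[of _ _ suminf] ext)
      (auto simp: coordinate_subspace_eq nth_analysis ip_scale_left ip_commute[of "f _" g, symmetric])
  finally show ?thesis .
qed

lemma synth_in_closed_subspace:
  assumes V: "subspace V" "closed V" "f ` J \<subseteq> V" and x: "x \<in> coordinate_subspace J"
  shows "synth x \<in> V"
proof (rule closed_sequentially[OF \<open>closed V\<close>])
  show "(\<lambda>k. \<Sum>n<k. scl (ell2_nth x n) (f n)) \<longlonglongrightarrow> synth x"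
    unfolding synthesis_operator_eq by (rule summable_LIMSEQ[OF summable_synthesis])
  have "scl (ell2_nth x n) (f n) \<in> V" for n
    using V x by (cases "n \<in> J")
      (auto simp: coordinate_subspace_eq intro: subspace_scale subspace_0)
  then show "(\<Sum>n<k. scl (ell2_nth x n) (f n)) \<in> V" for k
    by (intro subspace_sum V)
qed

lemma frame_with_bounds_iff_analysis:
  "frame_with_bounds ip J f V a b \<longleftrightarrow> 0 < a \<and> 0 < b \<and> f ` J \<subseteq> V \<and>
     (\<forall>g\<in>V. a * (norm g)\<^sup>2 \<le> (norm (analysis J g))\<^sup>2 \<and> (norm (analysis J g))\<^sup>2 \<le> b * (norm g)\<^sup>2)"
proof -
  have "((\<lambda>n. (norm (ip g (f n)))\<^sup>2) has_sum (norm (analysis J g))\<^sup>2) J" for g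
  proof -
    have "((\<lambda>n. (norm (ell2_nth (analysis J g) n))\<^sup>2) has_sum (norm (analysis J g))\<^sup>2) UNIV"
      unfolding norm_ell2_sq
      by (intro norm_summable_imp_has_sum) (simp_all add: summable_ell2 summable_sums)
    then show ?thesis
      using has_sum_cong_neutral[of UNIV J "\<lambda>n. (norm (ell2_nth (analysis J g) n))\<^sup>2"
          "\<lambda>n. (norm (ip g (f n)))\<^sup>2"]
      by (simp add: nth_analysis)
  qed
  then have "(\<lambda>n. (norm (ip g (f n)))\<^sup>2) summable_on J"
    "(\<Sum>\<^sub>\<infinity>n\<in>J. (norm (ip g (f n)))\<^sup>2) = (norm (analysis J g))\<^sup>2" for g
    by (blast intro: has_sum_imp_summable, blast intro: infsumI)
  then show ?thesis by (simp add: frame_with_bounds_def)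
qed

section \<open>Frame bounds, lower bounds for the synthesis operator, and angles\<close>

text \<open>
  If \<open>x\<close> is itself an analysis sequence, \<open>x = C g\<close>, then \<open>\<parallel>C g\<parallel>\<^sup>2 = \<langle>T C g, g\<rangle> \<le> \<parallel>T C g\<parallel> \<parallel>g\<parallel>\<close>, and the
  frame inequality bounds \<open>\<parallel>g\<parallel>\<close> by \<open>\<parallel>C g\<parallel>\<close>. By continuity the estimate persists on the closure \<open>R\<close> of
  the range of \<open>C\<close>, so it remains to see that \<open>R\<close> contains every \<open>x\<close> that is orthogonal to the
  kernel. The part of \<open>x\<close> orthogonal to \<open>R\<close> is mapped by \<open>T\<close> to a vector of \<open>V\<close> orthogonal to all of
  \<open>V\<close>, hence to \<open>0\<close>; so it lies in the kernel, is therefore orthogonal to \<open>x\<close>, and vanishes.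
\<close>

lemma synth_lower_bound_of_frame_bound:
  assumes V: "subspace V" "closed V" "f ` J \<subseteq> V"
    and "0 < a" and frame: "\<And>g. g \<in> V \<Longrightarrow> a * (norm g)\<^sup>2 \<le> (norm (analysis J g))\<^sup>2"
    and x: "x \<in> coordinate_subspace J"
    and orth: "\<And>z. z \<in> nullspace synth \<inter> coordinate_subspace J \<Longrightarrow> ell2_ip x z = 0"
  shows "a * (norm x)\<^sup>2 \<le> (norm (synth x))\<^sup>2"
proof -
  define R where "R = closure (analysis J ` V)"
  have "ell2.subspace R" "closed R"
    unfolding R_def by (auto intro: ell2.subspace_closure subspace_analysis_image V)
  then obtain p where "p \<in> R" and p: "\<And>v. v \<in> R \<Longrightarrow> ell2_ip (x - p) v = 0"
    using ell2.orthogonal_projection_exists by blast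
  have "R \<subseteq> coordinate_subspace J"
    unfolding R_def by (intro closure_minimal closed_coordinate_subspace)
      (auto simp: analysis_in_coordinate_subspace)
  then have xp: "x - p \<in> coordinate_subspace J"
    using x \<open>p \<in> R\<close> by (intro ell2.subspace_diff subspace_coordinate_subspace) auto
  have "synth (x - p) \<in> V" by (rule synth_in_closed_subspace[OF V xp])
  then have "analysis J (synth (x - p)) \<in> R"
    unfolding R_def by (intro subsetD[OF closure_subset] imageI)
  then have "ip (synth (x - p)) (synth (x - p)) = 0"
    unfolding ip_synth[OF xp] by (rule p)
  then have "x - p \<in> nullspace synth \<inter> coordinate_subspace J"
    using xp by (simp add: nullspace_def)
  then have "ell2_ip x (x - p) = 0" by (rule orth)
  moreover have "ell2_ip p (x - p) = 0"
    using p[OF \<open>p \<in> R\<close>] by (subst ell2.ip_eq_0_commute)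
  ultimately have "ell2_ip (x - p) (x - p) = 0"
    by (simp only: ell2.ip_diff_left diff_self)
  then have "x \<in> R" using \<open>p \<in> R\<close> by simp
  have "analysis J ` V \<subseteq> {y. a * (norm y)\<^sup>2 \<le> (norm (synth y))\<^sup>2}"
  proof safe
    fix g assume "g \<in> V"
    define y where "y = analysis J g"
    have "(norm y)\<^sup>2 = norm (ip (synth y) g)"
      unfolding y_def ip_synth[OF analysis_in_coordinate_subspace] by (simp add: ell2.norm_ip_self)
    also have "\<dots> \<le> norm (synth y) * norm g" by (rule cauchy_schwarz)
    finally have "((norm y)\<^sup>2)\<^sup>2 \<le> (norm (synth y))\<^sup>2 * (norm g)\<^sup>2"
      by (metis power_mono power_mult_distrib zero_le_power2)
    then have "a * ((norm y)\<^sup>2)\<^sup>2 \<le> (norm (synth y))\<^sup>2 * (a * (norm g)\<^sup>2)"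
      using \<open>0 < a\<close> by (simp add: mult.left_commute)
    also have "\<dots> \<le> (norm (synth y))\<^sup>2 * (norm y)\<^sup>2"
      using frame[OF \<open>g \<in> V\<close>] by (intro mult_left_mono) (simp_all add: y_def)
    finally have "(a * (norm y)\<^sup>2) * (norm y)\<^sup>2 \<le> (norm (synth y))\<^sup>2 * (norm y)\<^sup>2"
      by (simp add: power2_eq_square mult_ac)
    then show "a * (norm y)\<^sup>2 \<le> (norm (synth y))\<^sup>2"
      by (cases "y = 0") (simp_all add: mult_le_cancel_right)
  qed
  moreover have "closed {y. a * (norm y)\<^sup>2 \<le> (norm (synth y))\<^sup>2}"
    by (intro closed_Collect_le continuous_intros
        bounded_linear.continuous_on[OF bounded_linear_synth])
  ultimately have "R \<subseteq> {y. a * (norm y)\<^sup>2 \<le> (norm (synth y))\<^sup>2}"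
    unfolding R_def by (rule closure_minimal)
  with \<open>x \<in> R\<close> show ?thesis by blast
qed

text \<open>
  The same estimate read backwards. A vector \<open>g\<close> of the span of the subfamily is \<open>T x\<close> with
  \<open>x \<in> M\<^sub>J\<close>, where \<open>x\<close> may be replaced by its part \<open>y\<close> orthogonal to the kernel. Then
  \<open>\<parallel>g\<parallel>\<^sup>2 = \<langle>y, C g\<rangle> \<le> \<parallel>y\<parallel> \<parallel>C g\<parallel>\<close>, and the lower bound for \<open>T\<close> controls \<open>\<parallel>y\<parallel>\<close> by \<open>\<parallel>g\<parallel>\<close>.
  Continuity extends the inequality from the span to its closure.
\<close>

lemma frame_bound_of_synth_lower_bound:
  assumes "0 < a"
    and lower: "\<And>x. \<lbrakk>x \<in> coordinate_subspace J;
        \<And>z. z \<in> nullspace synth \<inter> coordinate_subspace J \<Longrightarrow> ell2_ip x z = 0\<rbrakk>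
      \<Longrightarrow> a * (norm x)\<^sup>2 \<le> (norm (synth x))\<^sup>2"
    and g: "g \<in> closed_span scl (f ` J)"
  shows "a * (norm g)\<^sup>2 \<le> (norm (analysis J g))\<^sup>2"
proof -
  let ?G = "{g. a * (norm g)\<^sup>2 \<le> (norm (analysis J g))\<^sup>2}"
  have "synth ` coordinate_subspace J \<subseteq> ?G"
  proof safe
    fix x :: "'k ell2"
    assume x: "x \<in> coordinate_subspace J"
    let ?K = "nullspace synth \<inter> coordinate_subspace J"
    have "ell2.subspace ?K" "closed ?K"
      by (auto intro: ell2.subspace_inter closed_Int subspace_nullspace_synth closed_nullspace_synth
          subspace_coordinate_subspace closed_coordinate_subspace)
    then obtain p where "p \<in> ?K" and p: "\<And>v. v \<in> ?K \<Longrightarrow> ell2_ip (x - p) v = 0"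
      using ell2.orthogonal_projection_exists by blast
    define y where "y = x - p"
    have y: "y \<in> coordinate_subspace J"
      unfolding y_def using x \<open>p \<in> ?K\<close>
      by (intro ell2.subspace_diff subspace_coordinate_subspace) auto
    have y_lower: "a * (norm y)\<^sup>2 \<le> (norm (synth y))\<^sup>2"
      using y p by (intro lower) (simp_all add: y_def)
    have "synth x = synth y"
      using \<open>p \<in> ?K\<close> by (simp add: y_def synth_diff nullspace_def)
    define g where "g = synth y"
    have "(norm g)\<^sup>2 = norm (ip (synth y) g)" by (simp add: g_def norm_ip_self)
    also have "\<dots> \<le> norm y * norm (analysis J g)"
      unfolding ip_synth[OF y] by (rule ell2.cauchy_schwarz)
    finally have "((norm g)\<^sup>2)\<^sup>2 \<le> (norm y)\<^sup>2 * (norm (analysis J g))\<^sup>2"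
      by (metis power_mono power_mult_distrib zero_le_power2)
    then have "a * ((norm g)\<^sup>2)\<^sup>2 \<le> (a * (norm y)\<^sup>2) * (norm (analysis J g))\<^sup>2"
      using \<open>0 < a\<close> by (simp add: mult.assoc)
    also have "\<dots> \<le> (norm g)\<^sup>2 * (norm (analysis J g))\<^sup>2"
      using y_lower by (intro mult_right_mono) (simp_all add: g_def)
    finally have "(a * (norm g)\<^sup>2) * (norm g)\<^sup>2 \<le> (norm (analysis J g))\<^sup>2 * (norm g)\<^sup>2"
      by (simp add: power2_eq_square mult_ac)
    then have "a * (norm g)\<^sup>2 \<le> (norm (analysis J g))\<^sup>2"
      by (cases "g = 0") (simp_all add: mult_le_cancel_right)
    then show "a * (norm (synth x))\<^sup>2 \<le> (norm (analysis J (synth x)))\<^sup>2"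
      by (simp add: g_def \<open>synth x = synth y\<close>)
  qed
  moreover have "span (f ` J) \<subseteq> synth ` coordinate_subspace J"
  proof (rule span_minimal)
    show "f ` J \<subseteq> synth ` coordinate_subspace J"
    proof safe
      fix n assume "n \<in> J"
      then have "ell2_basis n \<in> coordinate_subspace J"
        by (auto simp: coordinate_subspace_eq ell2_basis.rep_eq)
      then show "f n \<in> synth ` coordinate_subspace J" by (metis imageI synth_basis)
    qed
    show "subspace (synth ` coordinate_subspace J)"
      using linear_synth
      by (intro module_hom.subspace_image[where ?s1.0 = ell2_scale] subspace_coordinate_subspace)
        (simp add: module_hom_iff_linear)
  qed
  moreover have "closed ?G"
    by (intro closed_Collect_le continuous_intros
        bounded_linear.continuous_on[OF bounded_linear_analysis])
  ultimately have "closed_span scl (f ` J) \<subseteq> ?G"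
    unfolding closed_span_def by (intro closure_minimal) auto
  with g show ?thesis by blast
qed

text \<open>
  For unit vectors \<open>x \<in> M\<^sub>J\<close> and \<open>z \<in> N\<close> as in the definition of the angle, \<open>T\<close> does not see the
  component of \<open>x\<close> along \<open>z\<close>. Removing it leaves a vector of squared length \<open>1 - \<bar>\<langle>x, z\<rangle>\<bar>\<^sup>2\<close> with the
  same image, so \<open>a \<le> \<parallel>T x\<parallel>\<^sup>2 \<le> B (1 - \<bar>\<langle>x, z\<rangle>\<bar>\<^sup>2)\<close>. The maximum with \<open>0\<close> is there for the case
  \<open>a > B\<close>, in which no such pair \<open>x\<close>, \<open>z\<close> exists and the cosine is \<open>0\<close>.
\<close>

lemma angle_cos_le_of_synth_lower_bound:
  assumes lower: "\<And>x. \<lbrakk>x \<in> coordinate_subspace J;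
        \<And>z. z \<in> nullspace synth \<inter> coordinate_subspace J \<Longrightarrow> ell2_ip x z = 0\<rbrakk>
      \<Longrightarrow> a * (norm x)\<^sup>2 \<le> (norm (synth x))\<^sup>2"
  shows "angle_cos ell2_ip (nullspace synth) (coordinate_subspace J) \<le> sqrt (max 0 (1 - a / B))"
  unfolding angle_cos_def
proof (rule cSup_least, safe)
  fix z x :: "'k ell2"
  assume z: "z \<in> nullspace synth" "norm z = 1" and x: "x \<in> coordinate_subspace J" "norm x = 1"
    and "x \<in> orth_complement ell2_ip (nullspace synth \<inter> coordinate_subspace J)"
  then have "a * (norm x)\<^sup>2 \<le> (norm (synth x))\<^sup>2"
    by (intro lower) (auto simp: orth_complement_def)
  moreover define y where "y = x - ell2_scale (ell2_ip x z) z"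
  have "synth y = synth x"
    using ell2.subspace_scale[OF subspace_nullspace_synth z(1)]
    by (simp add: y_def synth_diff nullspace_def)
  moreover have "(norm (synth y))\<^sup>2 \<le> B * (norm y)\<^sup>2"
    using power_mono[OF norm_synth_le, of y 2] B_pos by (simp add: power_mult_distrib)
  moreover have "(norm y)\<^sup>2 = 1 - (norm (ell2_ip x z))\<^sup>2"
  proof -
    have "z \<noteq> 0" using z(2) by auto
    from ell2.norm_sq_residual[OF this, of x] show ?thesis by (simp add: y_def z(2) x(2))
  qed
  ultimately have "a \<le> B * (1 - (norm (ell2_ip x z))\<^sup>2)" using x by simp
  then have "(norm (ell2_ip z x))\<^sup>2 \<le> 1 - a / B"
    using B_pos by (simp add: ell2.norm_ip_commute[of z] field_simps)
  then show "norm (ell2_ip z x) \<le> sqrt (max 0 (1 - a / B))"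
    by (intro real_le_rsqrt) simp
qed auto

text \<open>
  Let \<open>n\<close> be the projection of \<open>x\<close> to \<open>N\<close>. It inherits from \<open>x\<close> the orthogonality to \<open>N \<inter> M\<^sub>J\<close>, so
  the pair \<open>n\<close>, \<open>x\<close> is admissible for the angle, and \<open>\<parallel>n\<parallel>\<^sup>2 = \<langle>x, n\<rangle> \<le> c \<parallel>x\<parallel> \<parallel>n\<parallel>\<close>. By Pythagoras
  \<open>(1 - c\<^sup>2) \<parallel>x\<parallel>\<^sup>2 \<le> \<parallel>x - n\<parallel>\<^sup>2\<close>. Since \<open>x - n\<close> is orthogonal to all of \<open>N\<close>, the frame bound of the
  whole family applies to it through duality with full index set, and \<open>T (x - n) = T x\<close>.
\<close>

lemma synth_lower_bound_of_angle_cos: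
  assumes frame: "frame_with_bounds ip UNIV f UNIV A b"
    and x: "x \<in> coordinate_subspace J"
    and orth: "\<And>z. z \<in> nullspace synth \<inter> coordinate_subspace J \<Longrightarrow> ell2_ip x z = 0"
  shows "A * (1 - (angle_cos ell2_ip (nullspace synth) (coordinate_subspace J))\<^sup>2) * (norm x)\<^sup>2
    \<le> (norm (synth x))\<^sup>2"
proof -
  let ?c = "angle_cos ell2_ip (nullspace synth) (coordinate_subspace J)"
  obtain n where n: "n \<in> nullspace synth" and xn: "\<And>z. z \<in> nullspace synth \<Longrightarrow> ell2_ip (x - n) z = 0"
    using ell2.orthogonal_projection_exists[OF subspace_nullspace_synth closed_nullspace_synth]
    by blast
  have "0 < A" and A: "A * (norm g)\<^sup>2 \<le> (norm (analysis UNIV g))\<^sup>2" for g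
    using frame by (auto simp: frame_with_bounds_iff_analysis)
  have "A * (norm (x - n))\<^sup>2 \<le> (norm (synth (x - n)))\<^sup>2"
    by (rule synth_lower_bound_of_frame_bound[of UNIV UNIV])
      (use xn A \<open>0 < A\<close> in \<open>auto simp: coordinate_subspace_UNIV subspace_UNIV\<close>)
  also have "synth (x - n) = synth x" using n by (simp add: synth_diff nullspace_def)
  finally have lower: "A * (norm (x - n))\<^sup>2 \<le> (norm (synth x))\<^sup>2" .
  have "ell2_ip n z = 0" if "z \<in> nullspace synth \<inter> coordinate_subspace J" for z
    using orth[OF that] xn[of z] that by (simp add: ell2.ip_diff_left)
  then have "norm (ell2_ip n x) \<le> ?c * (norm n * norm x)"
    using n x orth
    by (intro ell2.norm_ip_le_angle_cos subspace_nullspace_synth subspace_coordinate_subspace)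
      (auto simp: orth_complement_def)
  moreover have "ell2_ip x n = ell2_ip n n" using xn[OF n] by (simp add: ell2.ip_diff_left)
  ultimately have "norm n * norm n \<le> (?c * norm x) * norm n"
    by (simp add: ell2.norm_ip_commute[of n x] ell2.norm_ip_self power2_eq_square mult_ac)
  then have "norm n \<le> ?c * norm x"
    by (cases "n = 0") (simp_all add: ell2.angle_cos_nonneg mult_le_cancel_right)
  then have "(norm n)\<^sup>2 \<le> ?c\<^sup>2 * (norm x)\<^sup>2"
    by (metis norm_ge_zero power_mono power_mult_distrib)
  then have "(1 - ?c\<^sup>2) * (norm x)\<^sup>2 \<le> (norm (x - n))\<^sup>2"
    using ell2.pythagoras[OF xn[OF n]] by (simp add: algebra_simps)
  then have "A * ((1 - ?c\<^sup>2) * (norm x)\<^sup>2) \<le> A * (norm (x - n))\<^sup>2"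
    using \<open>0 < A\<close> by simp
  with lower show ?thesis by (simp add: mult.assoc)
qed

end

theorem proposition3p7:
  fixes scl :: "'k::rc_field \<Rightarrow> 'h::banach \<Rightarrow> 'h"
    and ip :: "'h \<Rightarrow> 'h \<Rightarrow> 'k"
    and f :: "nat \<Rightarrow> 'h"
  assumes "hilbert_space scl ip"
    and "separable_space (euclidean :: 'h topology)"
    and "is_frame ip f"
  shows "conditional_riesz_frame scl ip f \<longleftrightarrow>
    (\<exists>I :: nat \<Rightarrow> nat set.
       (\<forall>n. finite (I n)) \<and> (\<forall>n. I n \<subseteq> I (Suc n)) \<and> (\<Union>n. I n) = UNIV \<and>
       (SUP n. angle_cos ell2_ip (nullspace (synthesis_operator scl f))
                 (coordinate_subspace (I n))) < 1)"
proof -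
  obtain A B where frame: "frame_with_bounds ip UNIV f UNIV A B"
    using assms(3) by (auto simp: is_frame_def)
  interpret bessel_sequence scl ip f B
  proof (intro bessel_sequence.intro bessel_sequence_axioms.intro assms(1))
    show "0 < B" using frame by (simp add: frame_with_bounds_def)
    have s: "(\<lambda>n. (norm (ip g (f n)))\<^sup>2) summable_on UNIV"
      and le: "(\<Sum>\<^sub>\<infinity>n. (norm (ip g (f n)))\<^sup>2) \<le> B * (norm g)\<^sup>2" for g
      using frame by (auto simp: frame_with_bounds_def)
    show "summable (\<lambda>n. (norm (ip g (f n)))\<^sup>2)" for g
      by (rule summable_on_imp_summable[OF s])
    have "(\<lambda>n. (norm (ip g (f n)))\<^sup>2) sums (\<Sum>\<^sub>\<infinity>n. (norm (ip g (f n)))\<^sup>2)" for g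
      by (rule has_sum_imp_sums[OF has_sum_infsum[OF s]])
    then show "(\<Sum>n. (norm (ip g (f n)))\<^sup>2) \<le> B * (norm g)\<^sup>2" for g
      using le[of g] by (simp add: sums_iff)
  qed
  let ?c = "\<lambda>J. angle_cos ell2_ip (nullspace synth) (coordinate_subspace J)"
  show ?thesis
  proof
    assume "conditional_riesz_frame scl ip f"
    then obtain I a b where I: "finite_exhaustion I"
      and ab: "\<And>n. frame_with_bounds ip (I n) f (closed_span scl (f ` I n)) a b"
      by (auto simp: conditional_riesz_frame_def frame_sequence_with_bounds_def)
    have "0 < a" using ab by (simp add: frame_with_bounds_def)
    have "?c (I n) \<le> sqrt (max 0 (1 - a / B))" for n
    proof (rule angle_cos_le_of_synth_lower_bound, rule synth_lower_bound_of_frame_bound)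
      show "subspace (closed_span scl (f ` I n))" "closed (closed_span scl (f ` I n))"
        by (simp_all add: closed_span_def subspace_closure)
    qed (use ab[of n] in \<open>auto simp: frame_with_bounds_iff_analysis\<close>)
    then have "(SUP n. ?c (I n)) \<le> sqrt (max 0 (1 - a / B))" by (intro cSUP_least) auto
    also have "\<dots> < 1" using \<open>0 < a\<close> B_pos by simp
    finally show "\<exists>I. (\<forall>n. finite (I n)) \<and> (\<forall>n. I n \<subseteq> I (Suc n)) \<and> (\<Union>n. I n) = UNIV \<and>
        (SUP n. ?c (I n)) < 1"
      using I by (auto simp: finite_exhaustion_def)
  next
    assume "\<exists>I. (\<forall>n. finite (I n)) \<and> (\<forall>n. I n \<subseteq> I (Suc n)) \<and> (\<Union>n. I n) = UNIV \<and>
        (SUP n. ?c (I n)) < 1"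
    then obtain I where I: "finite_exhaustion I" and less: "(SUP n. ?c (I n)) < 1"
      by (auto simp: finite_exhaustion_def)
    define c where "c = (SUP n. ?c (I n))"
    \<comment> \<open>All cosines are at most \<open>1\<close>, so their \<open>SUP\<close> is a genuine upper bound.\<close>
    have le_c: "?c (I n) \<le> c" for n
      unfolding c_def by (intro cSUP_upper bdd_aboveI2[of _ _ 1] ell2.angle_cos_le_1) simp
    have "0 \<le> c" using le_c[of 0] ell2.angle_cos_nonneg order_trans by blast
    have "0 < A" using frame by (simp add: frame_with_bounds_def)
    have "c\<^sup>2 < 1" using \<open>0 \<le> c\<close> less by (simp add: c_def power_less_one_iff)
    then have pos: "0 < A * (1 - c\<^sup>2)" using \<open>0 < A\<close> by simp
    have "frame_with_bounds ip (I n) f (closed_span scl (f ` I n)) (A * (1 - c\<^sup>2)) B" for n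
      unfolding frame_with_bounds_iff_analysis
    proof (intro conjI ballI pos B_pos norm_analysis_sq_le)
      show "f ` I n \<subseteq> closed_span scl (f ` I n)"
        unfolding closed_span_def using span_superset closure_subset by (rule order_trans)
      fix g assume "g \<in> closed_span scl (f ` I n)"
      then show "A * (1 - c\<^sup>2) * (norm g)\<^sup>2 \<le> (norm (analysis (I n) g))\<^sup>2"
      proof (rule frame_bound_of_synth_lower_bound[OF pos, rotated])
        fix x assume x: "x \<in> coordinate_subspace (I n)"
          "\<And>z. z \<in> nullspace synth \<inter> coordinate_subspace (I n) \<Longrightarrow> ell2_ip x z = 0"
        have "(?c (I n))\<^sup>2 \<le> c\<^sup>2" by (intro power_mono le_c ell2.angle_cos_nonneg)
        then have "A * (1 - c\<^sup>2) * (norm x)\<^sup>2 \<le> A * (1 - (?c (I n))\<^sup>2) * (norm x)\<^sup>2"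
          using \<open>0 < A\<close> by (intro mult_right_mono mult_left_mono) auto
        also have "\<dots> \<le> (norm (synth x))\<^sup>2"
          by (rule synth_lower_bound_of_angle_cos[OF frame x])
        finally show "A * (1 - c\<^sup>2) * (norm x)\<^sup>2 \<le> (norm (synth x))\<^sup>2" .
      qed
    qed
    then show "conditional_riesz_frame scl ip f"
      using I assms(3) unfolding conditional_riesz_frame_def frame_sequence_with_bounds_def by blast
  qed
qed

end
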